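(* Let $\mathbf A=\langle A,\wedge,\vee,\cdot,{\sim},-,\neg,1\rangle$ be a distributive quasi relation algebra. If $p$ is a positive symmetric idempotent of $\mathbf A$ and there exists $b\in A$ such that $pb=b=bp$, $-p<b<p$ and $b^2\leqslant -p$, then $\mathbf A$ is not finitely representable.
   Context: A quasi relation algebra (qRA) is an algebra $\mathbf A=\langle A,\wedge,\vee,\cdot,{\sim},-,\neg,1\rangle$ such that $\langle A,\wedge,\vee\rangle$ is a lattice (order $\leqslant$, strict order $<$), $\langle A,\cdot,1\rangle$ is a monoid, and for all $a,b,c$: $ab\leqslant c$ iff $a\leqslant -(b\cdot{\sim}c)$ iff $b\leqslant {\sim}(-c\cdot a)$; ${\sim}{-}a=a={-}{\sim}a$; $\neg\neg a=a$; $\neg(a\vee b)=\neg a\wedge\neg b$; $\neg(ab)=\neg a+\neg b$ where $a+b:={\sim}(-a\cdot-b)$. It is distributive (a DqRA) if its lattice reduct is distributive. An element $p$ is positive if $1\leqslant p$, symmetric if ${\sim}p=-p=\neg p$, idempotent if $pp=p$; $b^2=bb$. Relational notation: for an equivalence relation $E$ on a set $X$ and $R,S\subseteq X^2$, $R^{\smile}=\{(y,x)\mid (x,y)\in R\}$, $R^c=\{(x,y)\in E\mid (x,y)\notin R\}$, $R;S=\{(x,y)\mid \exists z\,((x,z)\in R,(z,y)\in S)\}$; a function $\gamma:X\to X$ is identified with its graph. Given a poset $(X,\leqslant)$, an equivalence relation $E$ on $X$ with ${\leqslant}\subseteq E$, an order automorphism $\alpha$ and a self-inverse dual order automorphism $\beta$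 of $(X,\leqslant)$ with $\alpha,\beta\subseteq E$ and $\alpha;\beta;\alpha=\beta$, order $E$ by $(u,v)\preccurlyeq(x,y)$ iff $x\leqslant u$ and $v\leqslant y$, and let $\mathsf{Up}(E)$ be the set of up-sets of $(E,\preccurlyeq)$; $\mathbf{Dq}(E)=\langle \mathsf{Up}(E),\cap,\cup,;,{\sim},-,\neg,\leqslant\rangle$ with ${\sim}R=R^{c\smile};\alpha$, $-R=\alpha;R^{c\smile}$, $\neg R=\alpha;\beta;R^c;\beta$ is a DqRA. A DqRA is finitely representable if it embeds (via an injective homomorphism) into some such $\mathbf{Dq}(E)$ with $X$ finite. *)

theory Defs
  imports "HOL-Algebra.Group"
begin

section \<open>Quasi relation algebras\<close>

record 'a qra = "'a monoid" +
  qmeet  :: "['a, 'a] \<Rightarrow> 'a" (infixl "\<curlywedge>\<index>" 70)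
  qjoin  :: "['a, 'a] \<Rightarrow> 'a" (infixl "\<curlyvee>\<index>" 65)
  qtilde :: "'a \<Rightarrow> 'a"
  qminus :: "'a \<Rightarrow> 'a"
  qneg   :: "'a \<Rightarrow> 'a"

definition qle :: "('a, 'm) qra_scheme \<Rightarrow> 'a \<Rightarrow> 'a \<Rightarrow> bool" (infix "\<preceq>\<index>" 50)
  where "x \<preceq>\<^bsub>A\<^esub> y \<longleftrightarrow> x \<curlywedge>\<^bsub>A\<^esub> y = x"

definition qless :: "('a, 'm) qra_scheme \<Rightarrow> 'a \<Rightarrow> 'a \<Rightarrow> bool" (infix "\<prec>\<index>" 50)
  where "x \<prec>\<^bsub>A\<^esub> y \<longleftrightarrow> x \<preceq>\<^bsub>A\<^esub> y \<and> x \<noteq> y"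

text \<open>The factors are not swapped here; the variant \<open>\<sim>(-y \<cdot> -x)\<close>, for which \<open>\<not>(x \<cdot> y) = \<not>x + \<not>y\<close>
  holds in all algebras \<open>Dq\<close> below, coincides with it when the product is commutative.\<close>

definition qplus :: "('a, 'm) qra_scheme \<Rightarrow> 'a \<Rightarrow> 'a \<Rightarrow> 'a"
  where "qplus A x y = qtilde A (qminus A x \<otimes>\<^bsub>A\<^esub> qminus A y)"

locale quasi_relation_algebra = monoid A for A (structure) +
  assumes meet_closed: "\<lbrakk>a \<in> carrier A; b \<in> carrier A\<rbrakk> \<Longrightarrow> a \<curlywedge> b \<in> carrier A"
    and join_closed: "\<lbrakk>a \<in> carrier A; b \<in> carrier A\<rbrakk> \<Longrightarrow> a \<curlyvee> b \<in> carrier A"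
    and tilde_closed: "a \<in> carrier A \<Longrightarrow> qtilde A a \<in> carrier A"
    and minus_closed: "a \<in> carrier A \<Longrightarrow> qminus A a \<in> carrier A"
    and neg_closed: "a \<in> carrier A \<Longrightarrow> qneg A a \<in> carrier A"
    and meet_comm: "\<lbrakk>a \<in> carrier A; b \<in> carrier A\<rbrakk> \<Longrightarrow> a \<curlywedge> b = b \<curlywedge> a"
    and join_comm: "\<lbrakk>a \<in> carrier A; b \<in> carrier A\<rbrakk> \<Longrightarrow> a \<curlyvee> b = b \<curlyvee> a"
    and meet_assoc: "\<lbrakk>a \<in> carrier A; b \<in> carrier A; c \<in> carrier A\<rbrakk>
      \<Longrightarrow> (a \<curlywedge> b) \<curlywedge> c = a \<curlywedge> (b \<curlywedge> c)"
    and join_assoc: "\<lbrakk>a \<in> carrier A; b \<in> carrier A; c \<in> carrier A\<rbrakk>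
      \<Longrightarrow> (a \<curlyvee> b) \<curlyvee> c = a \<curlyvee> (b \<curlyvee> c)"
    and meet_join_absorb: "\<lbrakk>a \<in> carrier A; b \<in> carrier A\<rbrakk> \<Longrightarrow> a \<curlywedge> (a \<curlyvee> b) = a"
    and join_meet_absorb: "\<lbrakk>a \<in> carrier A; b \<in> carrier A\<rbrakk> \<Longrightarrow> a \<curlyvee> (a \<curlywedge> b) = a"
    and residuation_left: "\<lbrakk>a \<in> carrier A; b \<in> carrier A; c \<in> carrier A\<rbrakk>
      \<Longrightarrow> a \<otimes> b \<preceq> c \<longleftrightarrow> a \<preceq> qminus A (b \<otimes> qtilde A c)"
    and residuation_right: "\<lbrakk>a \<in> carrier A; b \<in> carrier A; c \<in> carrier A\<rbrakk>
      \<Longrightarrow> a \<otimes> b \<preceq> c \<longleftrightarrow> b \<preceq> qtilde A (qminus A c \<otimes> a)"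
    and tilde_minus: "a \<in> carrier A \<Longrightarrow> qtilde A (qminus A a) = a"
    and minus_tilde: "a \<in> carrier A \<Longrightarrow> qminus A (qtilde A a) = a"
    and neg_neg: "a \<in> carrier A \<Longrightarrow> qneg A (qneg A a) = a"
    and neg_join: "\<lbrakk>a \<in> carrier A; b \<in> carrier A\<rbrakk>
      \<Longrightarrow> qneg A (a \<curlyvee> b) = qneg A a \<curlywedge> qneg A b"
    and neg_mult: "\<lbrakk>a \<in> carrier A; b \<in> carrier A\<rbrakk>
      \<Longrightarrow> qneg A (a \<otimes> b) = qplus A (qneg A a) (qneg A b)"

locale distributive_quasi_relation_algebra = quasi_relation_algebra +
  assumes meet_join_distrib: "\<lbrakk>a \<in> carrier A; b \<in> carrier A; c \<in> carrier A\<rbrakk>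
      \<Longrightarrow> a \<curlywedge> (b \<curlyvee> c) = (a \<curlywedge> b) \<curlyvee> (a \<curlywedge> c)"

definition positive_elem :: "('a, 'm) qra_scheme \<Rightarrow> 'a \<Rightarrow> bool"
  where "positive_elem A p \<longleftrightarrow> \<one>\<^bsub>A\<^esub> \<preceq>\<^bsub>A\<^esub> p"

definition symmetric_elem :: "('a, 'm) qra_scheme \<Rightarrow> 'a \<Rightarrow> bool"
  where "symmetric_elem A p \<longleftrightarrow> qtilde A p = qminus A p \<and> qminus A p = qneg A p"

definition idempotent_elem :: "('a, 'm) qra_scheme \<Rightarrow> 'a \<Rightarrow> bool"
  where "idempotent_elem A p \<longleftrightarrow> p \<otimes>\<^bsub>A\<^esub> p = p"

definition qra_hom :: "('a, 'm) qra_scheme \<Rightarrow> ('b, 'n) qra_scheme \<Rightarrow> ('a \<Rightarrow> 'b) set"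
  where "qra_hom A B = {h. h \<in> carrier A \<rightarrow> carrier B \<and> h \<one>\<^bsub>A\<^esub> = \<one>\<^bsub>B\<^esub> \<and>
    (\<forall>x \<in> carrier A. \<forall>y \<in> carrier A.
       h (x \<curlywedge>\<^bsub>A\<^esub> y) = h x \<curlywedge>\<^bsub>B\<^esub> h y \<and>
       h (x \<curlyvee>\<^bsub>A\<^esub> y) = h x \<curlyvee>\<^bsub>B\<^esub> h y \<and>
       h (x \<otimes>\<^bsub>A\<^esub> y) = h x \<otimes>\<^bsub>B\<^esub> h y) \<and>
    (\<forall>x \<in> carrier A.
       h (qtilde A x) = qtilde B (h x) \<and>
       h (qminus A x) = qminus B (h x) \<and>
       h (qneg A x) = qneg B (h x))}"

section \<open>Algebras of binary relations\<close>

text \<open>A map \<open>X \<rightarrow> X\<close> is a function on the ambient type whose values outside \<open>X\<close> are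
  irrelevant; as a relation it is its graph over \<open>X\<close>. Relational composition is \<^const>\<open>relcomp\<close>,
  which composes from left to right.\<close>

definition graph_on :: "'x set \<Rightarrow> ('x \<Rightarrow> 'x) \<Rightarrow> 'x rel"
  where "graph_on X f = {(x, f x) | x. x \<in> X}"

definition order_automorphism :: "'x set \<Rightarrow> 'x rel \<Rightarrow> ('x \<Rightarrow> 'x) \<Rightarrow> bool"
  where "order_automorphism X leq f \<longleftrightarrow> bij_betw f X X \<and>
    (\<forall>x \<in> X. \<forall>y \<in> X. (x, y) \<in> leq \<longleftrightarrow> (f x, f y) \<in> leq)"

definition dual_order_automorphism :: "'x set \<Rightarrow> 'x rel \<Rightarrow> ('x \<Rightarrow> 'x) \<Rightarrow> bool"
  where "dual_order_automorphism X leq f \<longleftrightarrow> bij_betw f X X \<and>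
    (\<forall>x \<in> X. \<forall>y \<in> X. (x, y) \<in> leq \<longleftrightarrow> (f y, f x) \<in> leq)"

locale dq_frame =
  fixes X :: "'x set" and leq :: "'x rel" and E :: "'x rel" and \<alpha> \<beta> :: "'x \<Rightarrow> 'x"
  assumes poset: "partial_order_on X leq"
    and equiv: "equiv X E"
    and leq_E: "leq \<subseteq> E"
    and alpha_auto: "order_automorphism X leq \<alpha>"
    and beta_dual_auto: "dual_order_automorphism X leq \<beta>"
    and beta_self_inverse: "\<And>x. x \<in> X \<Longrightarrow> \<beta> (\<beta> x) = x"
    and alpha_E: "graph_on X \<alpha> \<subseteq> E"
    and beta_E: "graph_on X \<beta> \<subseteq> E"
    and alpha_beta_alpha: "graph_on X \<alpha> O graph_on X \<beta> O graph_on X \<alpha> = graph_on X \<beta>"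

definition upsets :: "'x rel \<Rightarrow> 'x rel \<Rightarrow> 'x rel set"
  where "upsets leq E = {R. R \<subseteq> E \<and>
    (\<forall>u v x y. (u, v) \<in> R \<and> (x, y) \<in> E \<and> (x, u) \<in> leq \<and> (v, y) \<in> leq \<longrightarrow> (x, y) \<in> R)}"

definition Dq :: "'x set \<Rightarrow> 'x rel \<Rightarrow> 'x rel \<Rightarrow> ('x \<Rightarrow> 'x) \<Rightarrow> ('x \<Rightarrow> 'x) \<Rightarrow> 'x rel qra"
  where "Dq X leq E \<alpha> \<beta> =
    \<lparr>carrier = upsets leq E, mult = (O), one = leq, qmeet = (\<inter>), qjoin = (\<union>),
     qtilde = (\<lambda>R. (E - R)\<inverse> O graph_on X \<alpha>),
     qminus = (\<lambda>R. graph_on X \<alpha> O (E - R)\<inverse>),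
     qneg = (\<lambda>R. graph_on X \<alpha> O graph_on X \<beta> O (E - R) O graph_on X \<beta>)\<rparr>"

text \<open>Existence of a representation over a finite subset of the type \<open>'x\<close>. Since HOL cannot
  quantify over types inside a formula, the type of base points is a parameter; a finite set
  embeds into every infinite type, so for infinite \<open>'x\<close> (such as \<^typ>\<open>nat\<close>) this is finite
  representability outright, and leaving \<open>'x\<close> free in a theorem ranges over all finite base sets.\<close>

definition finitely_representable :: "'x itself \<Rightarrow> ('a, 'm) qra_scheme \<Rightarrow> bool"
  where "finitely_representable (_ :: 'x itself) A \<longleftrightarrow>
    (\<exists>(X :: 'x set) leq E \<alpha> \<beta> h. finite X \<and> dq_frame X leq E \<alpha> \<beta> \<and>
       h \<in> qra_hom A (Dq X leq E \<alpha> \<beta>) \<and> inj_on h (carrier A))"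

end

theory Submission
  imports Defs
begin

text \<open>Let \<open>P\<close> and \<open>B\<close> represent \<open>p\<close> and \<open>b\<close>. Then \<open>P\<close> is a preorder on \<open>X\<close>, symmetry of \<open>p\<close> makes it
  invariant under \<open>\<alpha>\<close>, and for \<open>(x, y) \<in> E\<close> the pair \<open>(x, y)\<close> lies in \<open>-P\<close> iff \<open>(y, \<alpha> x) \<notin> P\<close>.
  A pair \<open>(x, y) \<in> B\<close> outside \<open>-P\<close> therefore satisfies \<open>x \<le> y \<le> \<alpha> x\<close> with respect to \<open>P\<close>. On a
  finite set, \<open>x \<le> \<alpha> x\<close> forces \<open>\<alpha> x \<le> x\<close>, so \<open>y \<le> x\<close> and \<open>(x, x) \<in> B O P = B\<close>. Now
  \<open>(x, x) \<in> B O B \<subseteq> -P\<close> says that \<open>(x, \<alpha> x) \<notin> P\<close>, a contradiction.\<close>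

lemma finite_preorder_increasing_map:
  assumes "finite X" and "inj_on f X" and "f ` X \<subseteq> X"
    and "refl_on X P" and "trans P"
    and mono: "\<And>u v. u \<in> X \<Longrightarrow> v \<in> X \<Longrightarrow> (u, v) \<in> P \<Longrightarrow> (f u, f v) \<in> P"
    and "x \<in> X" and "(x, f x) \<in> P"
  shows "(f x, x) \<in> P"
proof -
  \<comment> \<open>\<open>f\<close> maps the finite principal up-set of \<open>x\<close> injectively into itself, hence onto it.\<close>
  define U where "U = {z \<in> X. (x, z) \<in> P}"
  have "f ` U \<subseteq> U"
    using assms(3,7,8) mono \<open>trans P\<close> by (auto simp: U_def dest: transD)
  moreover have "finite U" "inj_on f U"
    using assms(1,2) by (auto simp: U_def intro: inj_on_subset)
  ultimately have "f ` U = U"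
    by (simp add: endo_inj_surj)
  moreover have "x \<in> U"
    using \<open>x \<in> X\<close> \<open>refl_on X P\<close> by (auto simp: U_def dest: refl_onD)
  \<comment> \<open>Surjectivity on \<open>U\<close> gives \<open>x\<close> itself a preimage
    \<open>z\<close> above \<open>x\<close>; applying the monotone \<open>f\<close> to
    \<open>(x, z)\<close> then yields \<open>(f x, x)\<close>.\<close>
  ultimately obtain z where "z \<in> X" "(x, z) \<in> P" "x = f z"
    unfolding U_def by blast
  then show ?thesis
    using mono[OF \<open>x \<in> X\<close>, of z] by simp
qed

context dq_frame
begin

lemma E_subset: "E \<subseteq> X \<times> X"
  using equiv by (auto simp: equiv_def refl_on_def)

lemma alpha_inj: "inj_on \<alpha> X"
  using alpha_auto by (simp add: order_automorphism_def bij_betw_def)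

lemma alpha_image: "\<alpha> ` X = X"
  using alpha_auto by (simp add: order_automorphism_def bij_betw_def)

lemma E_sym: "(x, y) \<in> E \<Longrightarrow> (y, x) \<in> E"
  using equiv by (meson equivE symE)

lemma E_trans: "(x, y) \<in> E \<Longrightarrow> (y, z) \<in> E \<Longrightarrow> (x, z) \<in> E"
  using equiv by (meson equivE transD)

lemma alpha_E': "x \<in> X \<Longrightarrow> (x, \<alpha> x) \<in> E"
  using alpha_E by (auto simp: graph_on_def)

text \<open>Complements are taken inside \<open>E\<close>, but \<alpha> stays within
  \<open>E\<close>-classes, so \<open>(y, \<alpha> x)\<close> lies in \<open>E\<close> automatically
  and only non-membership in \<open>R\<close> remains.\<close>

lemma minus_iff:
  assumes "(x, y) \<in> E"
  shows "(x, y) \<in> qminus (Dq X leq E \<alpha> \<beta>) R \<longleftrightarrow> (y, \<alpha> x) \<notin> R"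
proof -
  have "x \<in> X" using assms E_subset by blast
  then have "(y, \<alpha> x) \<in> E"
    using assms alpha_E' E_sym E_trans by blast
  with \<open>x \<in> X\<close> show ?thesis
    by (auto simp: Dq_def graph_on_def)
qed

text \<open>Test the pair \<open>(v, \<alpha> u)\<close>: by injectivity of \<alpha> it lies in
  \<open>qtilde\<close> of \<open>R\<close> iff \<open>(u, v)\<close> is not in \<open>R\<close>,
  and by \<open>minus_iff\<close> it lies in \<open>qminus\<close> of \<open>R\<close> iff
  \<open>(\<alpha> u, \<alpha> v)\<close> is not in \<open>R\<close>.\<close>

lemma symmetric_imp_alpha_invariant:
  assumes sym: "qtilde (Dq X leq E \<alpha> \<beta>) R = qminus (Dq X leq E \<alpha> \<beta>) R"
    and "R \<subseteq> E" and "(u, v) \<in> R"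
  shows "(\<alpha> u, \<alpha> v) \<in> R"
proof (rule ccontr)
  assume neg: "(\<alpha> u, \<alpha> v) \<notin> R"
  have uv: "(u, v) \<in> E" "u \<in> X" "v \<in> X"
    using assms E_subset by auto
  then have "(v, \<alpha> u) \<in> E"
    using alpha_E' E_sym E_trans by blast
  with neg have "(v, \<alpha> u) \<in> qtilde (Dq X leq E \<alpha> \<beta>) R"
    by (simp add: minus_iff sym)
  then obtain z where "(z, v) \<in> E - R" "z \<in> X" "\<alpha> u = \<alpha> z"
    by (auto simp: Dq_def graph_on_def)
  with uv alpha_inj have "(u, v) \<notin> R"
    by (auto dest: inj_onD)
  with \<open>(u, v) \<in> R\<close> show False by simp
qed

lemma finite_frame_no_square_below_minus:
  assumes "finite X"
    and P: "P \<subseteq> E" "leq \<subseteq> P" "P O P = P"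
    and sym: "qtilde (Dq X leq E \<alpha> \<beta>) P = qminus (Dq X leq E \<alpha> \<beta>) P"
    and B: "B O P = B" "B \<subseteq> P" "B O B \<subseteq> qminus (Dq X leq E \<alpha> \<beta>) P"
  shows "B \<subseteq> qminus (Dq X leq E \<alpha> \<beta>) P"
proof (rule subrelI, rule ccontr)
  fix x y
  assume xyB: "(x, y) \<in> B" and "(x, y) \<notin> qminus (Dq X leq E \<alpha> \<beta>) P"
  then have y_le: "(y, \<alpha> x) \<in> P"
    using minus_iff P B by blast
  have xy: "(x, y) \<in> P" using xyB B by blast
  then have "x \<in> X" using P E_subset by blast
  have refl: "refl_on X P"
    using poset P E_subset by (auto simp: refl_on_def partial_order_on_def preorder_on_def)
  have trans: "trans P"
    using P(3) by (metis relcomp.relcompI transI)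
  have x_le: "(x, \<alpha> x) \<in> P"
    using xy y_le trans by (blast dest: transD)
  \<comment> \<open>Finiteness of \<open>X\<close> enters here, with \<alpha> as the injective
    monotone map.\<close>
  then have "(\<alpha> x, x) \<in> P"
    using finite_preorder_increasing_map[OF \<open>finite X\<close> alpha_inj _ refl trans _ \<open>x \<in> X\<close>]
      symmetric_imp_alpha_invariant[OF sym P(1)] alpha_image by blast
  then have "(y, x) \<in> P"
    using y_le trans by (blast dest: transD)
  then have "(x, x) \<in> B" using xyB B(1) by blast
  then have "(x, x) \<in> qminus (Dq X leq E \<alpha> \<beta>) P" using B(3) by blast
  moreover have "(x, x) \<in> E" using refl \<open>x \<in> X\<close> P by (auto dest: refl_onD)
  ultimately show False using x_le minus_iff by blast
qed

end

lemma qra_hom_Dq_mono: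
  assumes "h \<in> qra_hom A (Dq X leq E \<alpha> \<beta>)" and "a \<in> carrier A" and "b \<in> carrier A"
    and "a \<preceq>\<^bsub>A\<^esub> b"
  shows "h a \<subseteq> h b"
proof -
  have "h (a \<curlywedge>\<^bsub>A\<^esub> b) = h a \<inter> h b"
    using assms(1-3) by (auto simp: qra_hom_def Dq_def)
  with assms(4) show ?thesis by (auto simp: qle_def)
qed

theorem theorem6:
  fixes A :: "('a, 'm) qra_scheme" (structure) and p :: 'a
  assumes "distributive_quasi_relation_algebra A"
    and "p \<in> carrier A"
    and "positive_elem A p" and "symmetric_elem A p" and "idempotent_elem A p"
    and "\<exists>b \<in> carrier A. p \<otimes> b = b \<and> b = b \<otimes> p \<and>
           qminus A p \<prec> b \<and> b \<prec> p \<and> b \<otimes> b \<preceq> qminus A p"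
  shows "\<not> finitely_representable TYPE('x) A"
proof
  interpret distributive_quasi_relation_algebra A by fact
  assume "finitely_representable TYPE('x) A"
  then obtain X :: "'x set" and leq E \<alpha> \<beta> h where fin: "finite X"
    and frame: "dq_frame X leq E \<alpha> \<beta>"
    and h: "h \<in> qra_hom A (Dq X leq E \<alpha> \<beta>)" and inj: "inj_on h (carrier A)"
    unfolding finitely_representable_def by blast
  from frame interpret dq_frame X leq E \<alpha> \<beta> .
  obtain b where b: "b \<in> carrier A" "b = b \<otimes> p"
      "qminus A p \<preceq> b" "qminus A p \<noteq> b" "b \<preceq> p" "b \<otimes> b \<preceq> qminus A p"
    using assms(6) by (auto simp: qless_def)
  have mult: "h (x \<otimes> y) = h x O h y" if "x \<in> carrier A" "y \<in> carrier A" for x y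
    using h that by (auto simp: qra_hom_def Dq_def)
  have minus: "h (qminus A p) = qminus (Dq X leq E \<alpha> \<beta>) (h p)"
    and tilde: "h (qtilde A p) = qtilde (Dq X leq E \<alpha> \<beta>) (h p)"
    using h \<open>p \<in> carrier A\<close> by (auto simp: qra_hom_def)
  have one: "h \<one> = leq"
    using h by (simp add: qra_hom_def Dq_def)
  note mono = qra_hom_Dq_mono[OF h]
  note mp = minus_closed[OF \<open>p \<in> carrier A\<close>]
  have "h p \<in> carrier (Dq X leq E \<alpha> \<beta>)"
    using h \<open>p \<in> carrier A\<close> by (auto simp: qra_hom_def)
  then have "h p \<subseteq> E" by (simp add: Dq_def upsets_def)
  \<comment> \<open>Positivity supplies reflexivity of \<open>h p\<close>, and idempotence its
    transitivity.\<close>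
  moreover have "leq \<subseteq> h p"
    using mono[OF one_closed \<open>p \<in> carrier A\<close>] assms(3) one by (simp add: positive_elem_def)
  moreover have "h p O h p = h p"
    using mult[OF \<open>p \<in> carrier A\<close> \<open>p \<in> carrier A\<close>] assms(5) by (simp add: idempotent_elem_def)
  moreover have "qtilde (Dq X leq E \<alpha> \<beta>) (h p) = qminus (Dq X leq E \<alpha> \<beta>) (h p)"
    using assms(4) minus tilde by (simp add: symmetric_elem_def)
  moreover have "h b O h p = h b"
    using mult[OF b(1) \<open>p \<in> carrier A\<close>] b(2) by simp
  moreover have "h b \<subseteq> h p"
    using mono b(1,5) assms(2) by blast
  moreover have "h b O h b \<subseteq> qminus (Dq X leq E \<alpha> \<beta>) (h p)"
    using mono[OF _ mp b(6)] mult[OF b(1) b(1)] minus b(1) by simp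
  ultimately have "h b \<subseteq> h (qminus A p)"
    unfolding minus by (rule finite_frame_no_square_below_minus[OF fin])
  moreover have "h (qminus A p) \<subseteq> h b"
    using mono mp b(1,3) by blast
  \<comment> \<open>The two inclusions make the images equal, so injectivity of \<open>h\<close>
    collapses the strict inequality between \<open>qminus A p\<close> and \<open>b\<close>.\<close>
  ultimately have "qminus A p = b"
    using inj mp b(1) by (auto dest: inj_onD)
  with b(4) show False by simp
qed

end
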